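(* Let $G=(V,E)$ be any $n$-vertex graph and suppose each vertex $v\in V$ is given a list $S(v)$ of colors. Suppose for every vertex $v \in V$ we independently sample a set $L(v)$ of $\ell$ colors uniformly at random from $S(v)$, where either (i) $S(v)$ is an arbitrary set of $(1+\varepsilon)\deg(v)$ colors and $\ell = \Theta(\varepsilon^{-1}\log n)$ for some $\varepsilon > 0$, or (ii) $S(v) = \{1,\ldots,\deg(v)+1\}$ and $\ell = \Theta(\log n)$. Then, with high probability, there exists a proper coloring of $G$ in which every vertex $v$ receives a color from $L(v)$.
   Context: $\deg(v)$ denotes the degree of $v$ in $G$. A proper coloring assigns distinct colors to adjacent vertices. The $\Theta(\cdot)$ in $\ell$ hides suitable absolute constants (with $\ell$ capped at $|S(v)|$). "With high probability" means with probability at least $1-1/\mathrm{poly}(n)$.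
   Formalization: In (i) the constant in ℓ may depend on an upper bound for ε (one constant for all ε fails: perfect matching, equal lists, ε ≈ C log n, ℓ=1); |S(v)| is (1+ε)deg(v) rounded up, and an isolated vertex gets one color, since an empty list makes the claim false. *)

theory Defs
  imports "HOL-Probability.Probability" "HOL-Probability.Product_PMF"
begin

definition simple_graph :: "'v set \<Rightarrow> 'v set set \<Rightarrow> bool" where
  "simple_graph V E \<longleftrightarrow> finite V \<and> (\<forall>e\<in>E. e \<subseteq> V \<and> card e = 2)"

definition vertex_degree :: "'v set set \<Rightarrow> 'v \<Rightarrow> nat" where
  "vertex_degree E v = card {e \<in> E. v \<in> e}"

definition proper_coloring :: "'v set set \<Rightarrow> ('v \<Rightarrow> 'c) \<Rightarrow> bool" where
  "proper_coloring E f \<longleftrightarrow> (\<forall>u v. {u, v} \<in> E \<longrightarrow> u \<noteq> v \<longrightarrow> f u \<noteq> f v)"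

definition list_colorable :: "'v set \<Rightarrow> 'v set set \<Rightarrow> ('v \<Rightarrow> 'c set) \<Rightarrow> bool" where
  "list_colorable V E L \<longleftrightarrow> (\<exists>f. proper_coloring E f \<and> (\<forall>v\<in>V. f v \<in> L v))"

text \<open>
  Independently for each \<open>v \<in> V\<close>, a uniformly random subset of \<open>S v\<close> of size \<open>l\<close>, where
  \<open>l\<close> is capped at the size of \<open>S v\<close>. The value \<open>{}\<close> outside \<open>V\<close> is immaterial.
\<close>
definition sample_lists :: "'v set \<Rightarrow> ('v \<Rightarrow> 'c set) \<Rightarrow> nat \<Rightarrow> ('v \<Rightarrow> 'c set) pmf" where
  "sample_lists V S l =
     Pi_pmf V {} (\<lambda>v. pmf_of_set {A. A \<subseteq> S v \<and> card A = min l (card (S v))})"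

definition prob_list_colorable ::
    "'v set \<Rightarrow> 'v set set \<Rightarrow> ('v \<Rightarrow> 'c set) \<Rightarrow> nat \<Rightarrow> real" where
  "prob_list_colorable V E S l =
     measure_pmf.prob (sample_lists V S l) {L. list_colorable V E L}"

text \<open>
  The number \<open>(1 + \<epsilon>) deg(v)\<close> of colors is rounded up to an integer (rounding down could leave
  fewer than \<open>deg(v) + 1\<close> colors), and an isolated vertex gets one color, since a vertex with
  an empty list can never be colored.
\<close>
definition num_colors :: "real \<Rightarrow> nat \<Rightarrow> nat" where
  "num_colors \<epsilon> d = max 1 (nat \<lceil>(1 + \<epsilon>) * real d\<rceil>)"

end

theory Submission
  imports Defs "HOL-Library.Discrete_Functions"
begin

text \<open>
  Both parts follow from one statement: if every list \<open>S v\<close> has more than \<open>deg v\<close> colors, then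
  sampling \<open>C log n\<close> of them suffices. The lists \<open>L v\<close> are revealed one color at a time. The vertices
  are inserted into a partial coloring one by one, and an uncolored vertex \<open>u\<close> (the token) draws a
  random color of \<open>S u\<close>. If no neighbour has it, \<open>u\<close> keeps it; if exactly one neighbour \<open>x\<close> has it,
  then with probability \<open>1/2\<close> the vertex \<open>u\<close> takes it and \<open>x\<close> becomes the token; otherwise \<open>u\<close> draws
  again. Fewer than \<open>card (S u)\<close> neighbours are colored, so there are more free colors than colors
  occurring at least twice, and hence the token moves to any given neighbour with probability at most
  \<open>1 / card (S u)\<close>, whatever the current coloring is. The number of visits of \<open>w\<close> is therefore
  dominated by the Green function of a killed random walk, which depends on the set \<open>A\<close> of inserted
  vertices only. It is at most \<open>2\<close>, and mass conservation bounds its sum over the boundary of \<open>A\<close>.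
  Inserting the vertices by increasing order of magnitude of \<open>card (S v)\<close>, and choosing well among
  those of the same magnitude, yields a harmonic sum: \<open>O(log n)\<close> visits of each vertex. An exponential
  potential turns this into a bound on the probability that some vertex runs out of colors.
\<close>

section \<open>The Green function of the walk\<close>

text \<open>By \<open>card_N\<close>, a walk that steps from \<open>u\<close> to each neighbor with
  probability \<open>1 / s u\<close> dies with positive probability at every step.\<close>

locale sampled_graph =
  fixes V :: "'v set" and N :: "'v \<Rightarrow> 'v set" and s :: "'v \<Rightarrow> nat"
  assumes finite_V: "finite V"
    and finite_N: "finite (N u)"
    and N_sym: "x \<in> N u \<longleftrightarrow> u \<in> N x"
    and N_irrefl: "u \<notin> N u"
    and card_N: "card (N u) < s u"
begin

lemma s_pos: "s u > 0"
  using card_N[of u] by simp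

lemma card_N_Int: "card (N u \<inter> A) < s u"
  using card_mono[OF finite_N, of "N u \<inter> A" u] card_N[of u] by simp

text \<open>Maximum principle: where \<open>f\<close> is maximal on \<open>A\<close>, fewer than
  \<open>s u\<close> summands cannot reach \<open>s u\<close> times a positive maximum.\<close>

lemma subharmonic_nonpos:
  fixes f :: "'v \<Rightarrow> real"
  assumes "finite A" "\<And>u. u \<in> A \<Longrightarrow> s u * f u \<le> (\<Sum>x\<in>N u \<inter> A. f x)" "u \<in> A"
  shows "f u \<le> 0"
proof -
  define m where "m = Max (f ` A)"
  have m_in: "m \<in> f ` A"
    unfolding m_def using assms by (intro Max_in) auto
  then obtain x where x: "x \<in> A" "f x = m" by auto
  have le_m: "f y \<le> m" if "y \<in> A" for y
    unfolding m_def using assms(1) that by auto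
  have "m \<le> 0"
  proof (rule ccontr)
    assume "\<not> m \<le> 0"
    have "s x * m \<le> (\<Sum>y\<in>N x \<inter> A. f y)" using assms(2)[OF x(1)] x(2) by simp
    also have "\<dots> \<le> (\<Sum>y\<in>N x \<inter> A. m)" by (intro sum_mono le_m) auto
    also have "\<dots> = real (card (N x \<inter> A)) * m" by simp
    also have "\<dots> < s x * m" using card_N_Int[of x A] \<open>\<not> m \<le> 0\<close> by simp
    finally show False by simp
  qed
  then show ?thesis using le_m[OF assms(3)] by simp
qed

text \<open>Expected number of visits of \<open>w\<close> among the first \<open>t\<close> positions
  of the walk from \<open>u\<close> that moves to each neighbor in \<open>A\<close> with probability
  \<open>1 / s u\<close> and dies otherwise. The start \<open>u\<close> may lie outside
  \<open>A\<close>.\<close>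

primrec green_iter :: "'v set \<Rightarrow> 'v \<Rightarrow> nat \<Rightarrow> 'v \<Rightarrow> real" where
  "green_iter A w 0 u = 0"
| "green_iter A w (Suc t) u =
     ((if u = w then real (s w) else 0) + (\<Sum>x\<in>N u \<inter> A. green_iter A w t x)) / s u"

definition green :: "'v set \<Rightarrow> 'v \<Rightarrow> 'v \<Rightarrow> real" where
  "green A w u = lim (\<lambda>t. green_iter A w t u)"

lemma green_iter_nonneg: "green_iter A w t u \<ge> 0"
  by (induction t arbitrary: u) (auto intro!: divide_nonneg_nonneg add_nonneg_nonneg sum_nonneg)

text \<open>The smaller bound off \<open>w\<close> closes the induction: at most
  \<open>s u - 1\<close> neighbors count one each, and the extra one for \<open>w\<close> still
  leaves at most \<open>s u\<close>.\<close>

lemma green_iter_le: "green_iter A w t u \<le> 1 + of_bool (u = w)"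
proof (induction t arbitrary: u)
  case (Suc t)
  have "(\<Sum>x\<in>N u \<inter> A. green_iter A w t x) \<le> (\<Sum>x\<in>N u \<inter> A. 1 + of_bool (x = w))"
    by (intro sum_mono Suc)
  also have "\<dots> = card (N u \<inter> A) + of_bool (w \<in> N u \<inter> A)"
    using finite_N[of u] by (simp add: sum.distrib of_bool_def sum.If_cases Int_commute[of _ "{w}"])
  also have "\<dots> \<le> s u"
    using card_N_Int[of u A] by (auto simp: of_bool_def)
  finally show ?case
    using s_pos[of u] by (auto simp: field_simps)
qed auto

lemma green_iter_mono: "green_iter A w t u \<le> green_iter A w (Suc t) u"
proof (induction t arbitrary: u)
  case 0
  show ?case using green_iter_nonneg[of A w "Suc 0" u] by simp
next
  case (Suc t)
  show ?case
    unfolding green_iter.simps(2)[of A w "Suc t" u] green_iter.simps(2)[of A w t u]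
    by (intro divide_right_mono add_left_mono sum_mono Suc) auto
qed

lemma green_LIMSEQ: "(\<lambda>t. green_iter A w t u) \<longlonglongrightarrow> green A w u"
proof -
  have "incseq (\<lambda>t. green_iter A w t u)"
    by (intro incseq_SucI green_iter_mono)
  moreover have "\<forall>t. green_iter A w t u \<le> 1 + of_bool (u = w)"
    by (intro allI green_iter_le)
  ultimately have "convergent (\<lambda>t. green_iter A w t u)"
    by (metis incseq_convergent convergent_def)
  then show ?thesis
    unfolding green_def by (simp add: convergent_LIMSEQ_iff)
qed

lemma green_nonneg: "green A w u \<ge> 0"
  by (rule LIMSEQ_le_const[OF green_LIMSEQ]) (intro exI allI impI green_iter_nonneg)

lemma green_le: "green A w u \<le> 1 + of_bool (u = w)"
  by (rule LIMSEQ_le_const2[OF green_LIMSEQ]) (intro exI allI impI green_iter_le)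

lemma green_eq:
  "s u * green A w u = (if u = w then real (s w) else 0) + (\<Sum>x\<in>N u \<inter> A. green A w x)"
proof -
  have "(\<lambda>t. green_iter A w (Suc t) u) \<longlonglongrightarrow>
      ((if u = w then real (s w) else 0) + (\<Sum>x\<in>N u \<inter> A. green A w x)) / s u"
    unfolding green_iter.simps using s_pos[of u] by (intro tendsto_intros green_LIMSEQ) auto
  with LIMSEQ_Suc[OF green_LIMSEQ[of A w u]]
  have "green A w u = ((if u = w then real (s w) else 0) + (\<Sum>x\<in>N u \<inter> A. green A w x)) / s u"
    by (rule LIMSEQ_unique)
  then show ?thesis using s_pos[of u] by (simp add: field_simps)
qed

lemma green_zero:
  assumes "w \<notin> A" "u \<in> A"
  shows "green A w u = 0"
proof -
  have "green_iter A w t u = 0" for t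
    using assms(2) by (induction t arbitrary: u) (use assms(1) in auto)
  then show ?thesis by (simp add: green_def)
qed

text \<open>
  Conservation of mass: every visit of a vertex \<open>x\<close> is lost into the complement of \<open>A\<close> at rate
  at least \<open>card (N x - A) / s x\<close>.
\<close>
lemma sum_boundary_green_le:
  assumes "finite A"
  shows "(\<Sum>x\<in>A. card (N x - A) * green A w x) \<le> s w"
proof -
  \<comment> \<open>Summing \<open>green_eq\<close> over all starts replaces an appeal to
    reversibility: by symmetry of \<open>N\<close>, each \<open>x\<close> is counted once per
    neighbor inside \<open>A\<close>.\<close>
  have "(\<Sum>u\<in>A. s u * green A w u) =
      (\<Sum>u\<in>A. if u = w then real (s w) else 0) + (\<Sum>u\<in>A. \<Sum>x\<in>N u \<inter> A. green A w x)"
    by (simp add: green_eq sum.distrib)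
  also have "(\<Sum>u\<in>A. \<Sum>x\<in>N u \<inter> A. green A w x) = (\<Sum>u\<in>A. \<Sum>x | x \<in> A \<and> x \<in> N u. green A w x)"
    by (intro sum.cong) auto
  also have "\<dots> = (\<Sum>x\<in>A. \<Sum>u | u \<in> A \<and> x \<in> N u. green A w x)"
    by (rule sum.swap_restrict[OF assms assms])
  also have "\<dots> = (\<Sum>x\<in>A. card (N x \<inter> A) * green A w x)"
    by (intro sum.cong refl) (simp add: N_sym Int_def conj_commute)
  also have "(\<Sum>u\<in>A. if u = w then real (s w) else 0) \<le> s w"
    using assms by simp
  finally have *: "(\<Sum>u\<in>A. s u * green A w u) - (\<Sum>x\<in>A. card (N x \<inter> A) * green A w x) \<le> s w"
    by simp
  have "(\<Sum>x\<in>A. card (N x - A) * green A w x)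
      \<le> (\<Sum>u\<in>A. s u * green A w u - card (N u \<inter> A) * green A w u)"
  proof (intro sum_mono)
    fix x
    have "card (N x - A) + card (N x \<inter> A) \<le> s x"
      using card_N[of x] card_Diff_subset_Int[of "N x" A] finite_N[of x]
        card_mono[OF finite_N, of "N x \<inter> A" x] by simp
    then have "real (card (N x - A)) \<le> real (s x) - card (N x \<inter> A)"
      by linarith
    from mult_right_mono[OF this green_nonneg[of A w x]]
    show "card (N x - A) * green A w x \<le> s x * green A w x - card (N x \<inter> A) * green A w x"
      by (simp add: algebra_simps)
  qed
  with * show ?thesis by (simp add: sum_subtractf)
qed

text \<open>Prices the insertion of \<open>v\<close> by the Green function of the old set
  \<open>A\<close>, so that prices can be summed over candidates \<open>v\<close>. The first step
  leads into \<open>A\<close>; the factor 2 pays for returns to \<open>v\<close>.\<close>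

lemma green_insert_le:
  assumes "finite A" "v \<notin> A" "w \<in> A"
  shows "green (insert v A) w v \<le> 2 / s v * (\<Sum>x\<in>N v \<inter> A. green A w x)"
proof -
  define g where "g = green (insert v A) w"
  define \<sigma> where "\<sigma> = g v"
  have \<sigma>: "\<sigma> \<ge> 0" by (simp add: \<sigma>_def g_def green_nonneg)
  have "w \<noteq> v" using assms by auto
  \<comment> \<open>From any neighbour, the walk reaches \<open>v\<close> before dying with probability at most \<open>1/2\<close>.\<close>
  have cmp: "g u - green A w u - \<sigma> / 2 \<le> 0" if "u \<in> A" for u
  proof (rule subharmonic_nonpos[OF assms(1) _ that])
    fix u assume u: "u \<in> A"
    define b where "b = (of_bool (v \<in> N u) :: real)"
    have split: "(\<Sum>x\<in>N u \<inter> insert v A. g x) = b * \<sigma> + (\<Sum>x\<in>N u \<inter> A. g x)"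
      using assms(2) finite_N[of u] by (auto simp: b_def \<sigma>_def Int_insert_right)
    have "real (card (N u \<inter> A)) + b \<le> card (N u)"
    proof (cases "v \<in> N u")
      case True
      then have "Suc (card (N u \<inter> A)) = card (insert v (N u \<inter> A))"
        using assms(2) finite_N[of u] by simp
      also have "\<dots> \<le> card (N u)" using True finite_N[of u] by (intro card_mono) auto
      finally show ?thesis using True by (simp add: b_def)
    qed (simp add: b_def finite_N card_mono)
    moreover have "real (card (N u)) + 1 \<le> s u" "b \<le> 1"
      using card_N[of u] by (auto simp: b_def)
    \<comment> \<open>Source of the 1/2: for a neighbor \<open>u\<close> of \<open>v\<close>, one
      unit of slack comes from \<open>v\<close> lying outside \<open>A\<close>, a second from the
      strict inequality \<open>card_N\<close>.\<close>
    ultimately have "card (N u \<inter> A) + 2 * b - s u \<le> 0" by linarith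
    then have "(card (N u \<inter> A) + 2 * b - s u) * (\<sigma> / 2) \<le> 0"
      using \<sigma> by (simp add: mult_nonpos_nonneg)
    moreover have "(\<Sum>x\<in>N u \<inter> A. g x - green A w x - \<sigma> / 2) =
        (\<Sum>x\<in>N u \<inter> A. g x) - (\<Sum>x\<in>N u \<inter> A. green A w x) - card (N u \<inter> A) * (\<sigma> / 2)"
      by (simp add: sum_subtractf)
    moreover have "s u * g u - s u * green A w u =
        b * \<sigma> + (\<Sum>x\<in>N u \<inter> A. g x) - (\<Sum>x\<in>N u \<inter> A. green A w x)"
      using green_eq[of u "insert v A" w] green_eq[of u A w] split by (simp add: g_def)
    ultimately show "s u * (g u - green A w u - \<sigma> / 2) \<le>
        (\<Sum>x\<in>N u \<inter> A. g x - green A w x - \<sigma> / 2)"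
      by (simp add: algebra_simps)
  qed
  have "s v * \<sigma> = (\<Sum>x\<in>N v \<inter> A. g x)"
    using green_eq[of v "insert v A" w] \<open>w \<noteq> v\<close> N_irrefl[of v]
    by (simp add: \<sigma>_def g_def Int_insert_right)
  also have "\<dots> \<le> (\<Sum>x\<in>N v \<inter> A. green A w x + \<sigma> / 2)"
    using cmp by (intro sum_mono) (auto simp: algebra_simps)
  also have "\<dots> = (\<Sum>x\<in>N v \<inter> A. green A w x) + card (N v \<inter> A) * (\<sigma> / 2)"
    by (simp add: sum.distrib)
  also have "card (N v \<inter> A) * (\<sigma> / 2) \<le> s v * (\<sigma> / 2)"
    using card_N_Int[of v A] \<sigma> by (intro mult_right_mono) auto
  finally have "s v * \<sigma> \<le> 2 * (\<Sum>x\<in>N v \<inter> A. green A w x)" by simp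
  then show ?thesis
    using s_pos[of v] by (simp add: \<sigma>_def g_def field_simps)
qed

end

section \<open>The potential of the recoloring process\<close>

lemma sum_card_fibres:
  assumes "finite X" "finite T"
  shows "(\<Sum>c\<in>T. \<Sum>x | x \<in> X \<and> f x = c. (g x :: real)) = (\<Sum>x | x \<in> X \<and> f x \<in> T. g x)"
proof -
  have "(\<Sum>c\<in>T. \<Sum>x | x \<in> X \<and> f x = c. g x) = (\<Sum>x\<in>X. \<Sum>c | c \<in> T \<and> f x = c. g x)"
    by (rule sum.swap_restrict[OF assms(2,1)])
  also have "\<dots> = (\<Sum>x\<in>X. if f x \<in> T then g x else 0)"
  proof (intro sum.cong refl)
    fix x
    have "{c. c \<in> T \<and> f x = c} = (if f x \<in> T then {f x} else {})" by auto
    then show "(\<Sum>c | c \<in> T \<and> f x = c. g x) = (if f x \<in> T then g x else 0)" by simp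
  qed
  also have "\<dots> = (\<Sum>x | x \<in> X \<and> f x \<in> T. g x)"
    by (rule sum.inter_filter[OF assms(1), symmetric])
  finally show ?thesis .
qed

text \<open>\<open>F L\<close> stands for the probability of failure given that the final lists
  contain \<open>L\<close>. Success is final by \<open>F_colorable\<close>, and by
  \<open>F_average\<close> the next color may be drawn from all of \<open>S u\<close>.\<close>

locale list_revealing = sampled_graph V N "\<lambda>v. card (S v)"
  for V :: "'v set" and N and S :: "'v \<Rightarrow> 'c set" +
  fixes l :: nat and F :: "('v \<Rightarrow> 'c set) \<Rightarrow> real"
  assumes N_subset: "u \<in> V \<Longrightarrow> N u \<subseteq> V"
    and F_le_1: "F L \<le> 1"
    and F_colorable:
      "\<lbrakk>\<And>u. u \<in> V \<Longrightarrow> L u \<subseteq> S u \<and> card (L u) \<le> l;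
        \<And>u. u \<in> V \<Longrightarrow> f u \<in> L u; \<And>u x. u \<in> V \<Longrightarrow> x \<in> N u \<Longrightarrow> f u \<noteq> f x\<rbrakk> \<Longrightarrow> F L = 0"
    and F_average:
      "\<lbrakk>u \<in> V; L u \<subseteq> S u; card (L u) < l\<rbrakk> \<Longrightarrow>
        F L = (\<Sum>c\<in>S u. F (L(u := insert c (L u)))) / card (S u)"
begin

lemma finite_S: "finite (S v)"
  using s_pos[of v] by (rule card_ge_0_finite)

text \<open>
  The numbers \<open>vis\<close> count the colors drawn so far; since repetitions are possible, they only
  bound the sizes of the revealed parts \<open>L\<close> of the lists.
\<close>
definition valid_state :: "'v set \<Rightarrow> ('v \<Rightarrow> 'c) \<Rightarrow> ('v \<Rightarrow> 'c set) \<Rightarrow> ('v \<Rightarrow> nat) \<Rightarrow> bool" where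
  "valid_state A f L vis \<longleftrightarrow>
     (\<forall>x\<in>A. f x \<in> L x) \<and> (\<forall>x\<in>A. \<forall>y\<in>N x \<inter> A. f x \<noteq> f y) \<and>
     (\<forall>x\<in>V. L x \<subseteq> S x \<and> card (L x) \<le> vis x \<and> vis x \<le> l)"

text \<open>The weight of \<open>w\<close> reaches \<open>(6 / 5) ^ l\<close> once its draws are
  used up; \<open>R w\<close> allows for the insertions still to come.\<close>

definition idle_potential :: "('v \<Rightarrow> nat) \<Rightarrow> ('v \<Rightarrow> real) \<Rightarrow> real" where
  "idle_potential vis R = (\<Sum>w\<in>V. (6 / 5) ^ vis w * R w)"

text \<open>The factor \<open>1 + green A w u\<close> pays for the draws at \<open>w\<close> in the
  current insertion, with the token at \<open>u\<close>.\<close>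

definition token_potential :: "'v set \<Rightarrow> 'v \<Rightarrow> ('v \<Rightarrow> nat) \<Rightarrow> ('v \<Rightarrow> real) \<Rightarrow> real" where
  "token_potential A u vis R = (\<Sum>w\<in>V. (6 / 5) ^ vis w * (1 + green A w u) * R w)"

text \<open>
  The expected potential after one draw at the token \<open>u\<close>, when a color with a unique conflicting
  neighbour is accepted with probability \<open>1/2\<close> only: this makes up for the draws that are rejected
  because of several conflicts.
\<close>
lemma token_average:
  fixes f :: "'v \<Rightarrow> 'c" and u :: 'v and A :: "'v set"
  defines "B \<equiv> \<lambda>c. {x \<in> N u \<inter> A. f x = c}"
  shows "(\<Sum>c\<in>S u. 1 + (\<Sum>x\<in>B c. (green A w x + green A w u) / 2)) * (6 / 5) ^ of_bool (w = u)
    \<le> card (S u) * (1 + green A w u)"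
proof -
  let ?g = "green A w"
  let ?s = "real (card (S u))"
  have "(\<Sum>c\<in>S u. \<Sum>x\<in>B c. (?g x + ?g u) / 2) =
      (\<Sum>x | x \<in> N u \<inter> A \<and> f x \<in> S u. (?g x + ?g u) / 2)"
    unfolding B_def by (rule sum_card_fibres) (use finite_N finite_S in auto)
  also have "\<dots> \<le> (\<Sum>x\<in>N u \<inter> A. (?g x + ?g u) / 2)"
    using finite_N[of u] green_nonneg by (intro sum_mono2) auto
  also have "\<dots> = (\<Sum>x\<in>N u \<inter> A. ?g x) / 2 + card (N u \<inter> A) * ?g u / 2"
    by (simp add: sum.distrib add_divide_distrib sum_divide_distrib)
  also have "card (N u \<inter> A) * ?g u \<le> ?s * ?g u"
    using card_N_Int[of u A] green_nonneg by (intro mult_right_mono) auto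
  finally have sum_le: "(\<Sum>c\<in>S u. \<Sum>x\<in>B c. (?g x + ?g u) / 2) \<le>
      (\<Sum>x\<in>N u \<inter> A. ?g x) / 2 + ?s * ?g u / 2"
    by simp
  show ?thesis
  proof (cases "w = u")
    case True
    have "(\<Sum>x\<in>N u \<inter> A. ?g x) = ?s * ?g u - ?s"
      using green_eq[of u A w] True by simp
    with sum_le have "(\<Sum>c\<in>S u. 1 + (\<Sum>x\<in>B c. (?g x + ?g u) / 2)) \<le> ?s * (1 / 2 + ?g u)"
      by (simp add: sum.distrib algebra_simps diff_divide_distrib)
    \<comment> \<open>Source of the base 6/5: \<open>(1 + g) / (1 / 2 + g)\<close> decreases in
      \<open>g\<close> and equals 6/5 at \<open>g = 2\<close>, the upper bound from
      \<open>green_le\<close>.\<close>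
    moreover have "?s * ((1 / 2 + ?g u) * (6 / 5)) \<le> ?s * (1 + ?g u)"
      using green_le[of A w u] True by (intro mult_left_mono) auto
    ultimately have "(\<Sum>c\<in>S u. 1 + (\<Sum>x\<in>B c. (?g x + ?g u) / 2)) * (6 / 5) \<le> ?s * (1 + ?g u)"
      by argo
    then show ?thesis using True by simp
  next
    case False
    then have "(\<Sum>x\<in>N u \<inter> A. ?g x) = ?s * ?g u"
      using green_eq[of u A w] by simp
    with sum_le False show ?thesis
      by (simp add: sum.distrib algebra_simps)
  qed
qed

lemma token_bound:
  assumes "A \<subseteq> V" "u \<in> A" "\<And>w. R w \<ge> 1"
    and idle: "\<And>f L vis. valid_state A f L vis \<Longrightarrow> (6 / 5) ^ l * F L \<le> idle_potential vis R"
    and "valid_state (A - {u}) f L vis"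
  shows "(6 / 5) ^ l * F L \<le> token_potential A u vis R"
  using assms(2,5)
proof (induction "\<Sum>w\<in>V. l - vis w" arbitrary: u f L vis rule: less_induct)
  case less
  note st = less.prems(2)
  have u: "u \<in> V" using less.prems assms by auto
  have nonneg: "0 \<le> (6 / 5) ^ k * (1 + green A w x) * R w" for w x and k :: nat
    using green_nonneg[of A w x] assms(3)[of w] by auto
  have st_u: "L u \<subseteq> S u" "card (L u) \<le> vis u" "vis u \<le> l"
    using st u by (auto simp: valid_state_def)
  show ?case
  proof (cases "vis u = l")
    case True
    have "(6 / 5) ^ l * F L \<le> (6 / 5) ^ l * 1"
      using F_le_1 by (intro mult_left_mono) auto
    also have "\<dots> \<le> (6 / 5) ^ l * ((1 + green A u u) * R u)"
      using mult_mono[of 1 "1 + green A u u" 1 "R u"] green_nonneg[of A u u] assms(3)[of u]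
      by (intro mult_left_mono) auto
    also have "\<dots> = (6 / 5) ^ vis u * (1 + green A u u) * R u"
      using True by simp
    also have "\<dots> \<le> token_potential A u vis R"
      unfolding token_potential_def by (intro member_le_sum u finite_V nonneg)
    finally show ?thesis .
  next
    case False
    with st_u have lt: "vis u < l" by simp
    define vis' where "vis' = vis(u := Suc (vis u))"
    define L' where "L' = (\<lambda>c. L(u := insert c (L u)))"
    define B where "B = (\<lambda>c. {x \<in> N u \<inter> A. f x = c})"
    have finite_B: "finite (B c)" for c using finite_N[of u] by (simp add: B_def)
    have less': "(\<Sum>w\<in>V. l - vis' w) < (\<Sum>w\<in>V. l - vis w)"
      by (rule sum_strict_mono_ex1[OF finite_V]) (use u lt in \<open>auto simp: vis'_def\<close>)
    have lists': "\<forall>x\<in>V. L' c x \<subseteq> S x \<and> card (L' c x) \<le> vis' x \<and> vis' x \<le> l"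
      if "c \<in> S u" for c
    proof -
      have "card (insert c (L u)) \<le> Suc (vis u)"
        using card_insert_le_m1[of "Suc (vis u)" "L u" c] st_u by simp
      then show ?thesis
        using st lt that by (auto simp: valid_state_def L'_def vis'_def)
    qed
    have colored: "f x \<in> L' c x" if "x \<in> A - {u}" for x c
      using st that by (auto simp: valid_state_def L'_def)
    \<comment> \<open>One formula for three outcomes: the inner sum is 0 without conflict, the mean
      of moving and staying for one conflict, and contains at least two halves of
      \<open>green A w u\<close> for several.\<close>
    have step: "(6 / 5) ^ l * F (L' c) \<le>
        (\<Sum>w\<in>V. (6 / 5) ^ vis' w * (1 + (\<Sum>x\<in>B c. (green A w x + green A w u) / 2)) * R w)"
      (is "_ \<le> ?rhs") if c: "c \<in> S u" for c
    proof -
      have "valid_state (A - {u}) f (L' c) vis'"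
        unfolding valid_state_def
      proof (intro conjI)
        show "\<forall>x\<in>A - {u}. f x \<in> L' c x" using colored by blast
        show "\<forall>x\<in>A - {u}. \<forall>y\<in>N x \<inter> (A - {u}). f x \<noteq> f y"
          using st unfolding valid_state_def by blast
      qed (rule lists'[OF c])
      from less.hyps[OF less' less.prems(1) this]
      have stay: "(6 / 5) ^ l * F (L' c) \<le> token_potential A u vis' R" .
      consider "B c = {}" | x where "B c = {x}" | "card (B c) \<ge> 2"
      proof -
        have "card (B c) = 0 \<or> card (B c) = 1 \<or> card (B c) \<ge> 2" by linarith
        then show thesis
          using that finite_B[of c] by (auto simp: card_1_singleton_iff)
      qed
      then show ?thesis
      proof cases
        case 1
        have "valid_state A (f(u := c)) (L' c) vis'"
          unfolding valid_state_def
        proof (intro conjI ballI)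
          fix y z assume yz: "y \<in> A" "z \<in> N y \<inter> A"
          have not: "f t \<noteq> c" if "t \<in> N u" "t \<in> A" for t
            using that 1 by (auto simp: B_def)
          show "(f(u := c)) y \<noteq> (f(u := c)) z"
          proof (cases "y = u \<or> z = u")
            case True
            then show ?thesis
              using not[of y] not[of z] yz N_sym[of y u] N_irrefl[of u] by auto
          next
            case False
            then have "y \<in> A - {u}" "z \<in> N y \<inter> (A - {u})" using yz by auto
            then have "f y \<noteq> f z" using st unfolding valid_state_def by blast
            then show ?thesis using False by simp
          qed
        next
          fix y assume "y \<in> A"
          then show "(f(u := c)) y \<in> L' c y"
            using colored[of y] by (cases "y = u") (auto simp: L'_def)
        qed (use lists'[OF c] in blast)+
        from idle[OF this] show ?thesis
          using 1 by (simp add: idle_potential_def)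
      next
        case (2 x)
        then have x: "x \<in> A" "x \<noteq> u" "x \<in> N u"
          using N_irrefl[of u] by (auto simp: B_def)
        have "valid_state (A - {x}) (f(u := c)) (L' c) vis'"
          unfolding valid_state_def
        proof (intro conjI ballI)
          fix y z assume yz: "y \<in> A - {x}" "z \<in> N y \<inter> (A - {x})"
          have not: "f t \<noteq> c" if "t \<in> N u" "t \<in> A" "t \<noteq> x" for t
            using that 2 by (auto simp: B_def)
          show "(f(u := c)) y \<noteq> (f(u := c)) z"
          proof (cases "y = u \<or> z = u")
            case True
            then show ?thesis
              using not[of y] not[of z] yz N_sym[of y u] N_irrefl[of u] by auto
          next
            case False
            then have "y \<in> A - {u}" "z \<in> N y \<inter> (A - {u})" using yz by auto
            then have "f y \<noteq> f z" using st unfolding valid_state_def by blast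
            then show ?thesis using False by simp
          qed
        next
          fix y assume "y \<in> A - {x}"
          then show "(f(u := c)) y \<in> L' c y"
            using colored[of y] by (cases "y = u") (auto simp: L'_def)
        qed (use lists'[OF c] in blast)+
        from less.hyps[OF less' x(1) this]
        have "(6 / 5) ^ l * F (L' c) \<le> token_potential A x vis' R" .
        \<comment> \<open>No coin is tossed: moving and staying both bound the same number, hence so
          does their mean.\<close>
        with stay have "(6 / 5) ^ l * F (L' c) \<le>
            (token_potential A x vis' R + token_potential A u vis' R) / 2" by simp
        also have "\<dots> = ?rhs"
          using 2 unfolding token_potential_def
          by (simp flip: sum.distrib add: sum_divide_distrib)
            (intro sum.cong refl, simp add: algebra_simps add_divide_distrib)
        finally show ?thesis .
      next
        case 3
        have "green A w u \<le> (\<Sum>x\<in>B c. (green A w x + green A w u) / 2)" for w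
        proof -
          have "green A w u \<le> card (B c) * (green A w u / 2)"
            using mult_right_mono[of 2 "real (card (B c))" "green A w u / 2"] 3 green_nonneg
            by simp
          also have "\<dots> = (\<Sum>x\<in>B c. green A w u / 2)" by simp
          also have "\<dots> \<le> (\<Sum>x\<in>B c. (green A w x + green A w u) / 2)"
            using green_nonneg by (intro sum_mono) simp
          finally show ?thesis .
        qed
        then have "token_potential A u vis' R \<le> ?rhs"
          unfolding token_potential_def
          using order_trans[OF zero_le_one assms(3)]
          by (intro sum_mono mult_right_mono mult_left_mono) auto
        with stay show ?thesis by simp
      qed
    qed
    let ?s = "real (card (S u))"
    have "?s * ((6 / 5) ^ l * F L) = (\<Sum>c\<in>S u. (6 / 5) ^ l * F (L' c))"
      using F_average[of u L] u st_u lt s_pos[of u] unfolding L'_def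
      by (simp flip: sum_distrib_left)
    also have "\<dots> \<le> (\<Sum>c\<in>S u. \<Sum>w\<in>V. (6 / 5) ^ vis' w *
        (1 + (\<Sum>x\<in>B c. (green A w x + green A w u) / 2)) * R w)"
      by (intro sum_mono step)
    also have "\<dots> = (\<Sum>w\<in>V. (6 / 5) ^ vis' w *
        (\<Sum>c\<in>S u. 1 + (\<Sum>x\<in>B c. (green A w x + green A w u) / 2)) * R w)"
      by (subst sum.swap) (simp only: sum_distrib_left sum_distrib_right)
    also have "\<dots> = (\<Sum>w\<in>V. (6 / 5) ^ vis w *
        ((\<Sum>c\<in>S u. 1 + (\<Sum>x\<in>B c. (green A w x + green A w u) / 2)) *
          (6 / 5) ^ of_bool (w = u)) * R w)"
      by (intro sum.cong refl) (auto simp: vis'_def)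
    also have "\<dots> \<le> (\<Sum>w\<in>V. (6 / 5) ^ vis w * (?s * (1 + green A w u)) * R w)"
      unfolding B_def using order_trans[OF zero_le_one assms(3)]
      by (intro sum_mono mult_right_mono mult_left_mono token_average) auto
    also have "\<dots> = ?s * token_potential A u vis R"
      by (simp add: token_potential_def sum_distrib_left mult_ac)
    finally show ?thesis
      using s_pos[of u] by simp
  qed
qed

section \<open>Dyadic scales of the list sizes and the order of insertion\<close>

definition scale :: "'v \<Rightarrow> nat" where
  "scale v = floor_log (card (S v))"

lemma scale_le: "2 ^ scale v \<le> card (S v)"
  using floor_log_exp2_le[OF s_pos[of v]] by (simp add: scale_def)

lemma scale_gt: "card (S v) < 2 * 2 ^ scale v"
  using floor_log_exp2_gt[of "card (S v)"] by (simp add: scale_def)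

definition top_scale :: nat where
  "top_scale = Max (scale ` V)"

lemma scale_le_top: "v \<in> V \<Longrightarrow> scale v \<le> top_scale"
  using finite_V by (simp add: top_scale_def)

text \<open>
  While \<open>r\<close> vertices of scale \<open>k\<close> are left, inserting a random one of them causes at most
  \<open>2 * card (S w) / (2 ^ k * r)\<close> expected visits of a vertex \<open>w\<close> inserted before. Scales below
  that of \<open>w\<close> do not contribute, because they are exhausted when \<open>w\<close> is inserted; this makes the
  sum over \<open>k\<close> a geometric one.
\<close>
definition future_visits :: "'v set \<Rightarrow> 'v \<Rightarrow> real" where
  "future_visits U w =
     2 * card (S w) * (\<Sum>k\<in>{scale w..top_scale}. harm (card {v \<in> U. scale v = k}) / 2 ^ k)"

text \<open>The 3 is a reserve for the insertion of \<open>w\<close> itself, where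
  \<open>1 + green\<close> is at most 3.\<close>

definition future_factor :: "'v set \<Rightarrow> 'v \<Rightarrow> real" where
  "future_factor U w = (if w \<in> U then 3 else 1) * exp (future_visits U w)"

lemma future_visits_nonneg: "future_visits U w \<ge> 0"
  unfolding future_visits_def
  by (intro mult_nonneg_nonneg sum_nonneg divide_nonneg_nonneg harm_nonneg) auto

lemma future_factor_ge_1: "future_factor U w \<ge> 1"
proof -
  have "1 \<le> exp (future_visits U w)" using future_visits_nonneg by simp
  moreover from this have "1 \<le> 3 * exp (future_visits U w)" by linarith
  ultimately show ?thesis by (simp add: future_factor_def)
qed

lemma future_visits_mono:
  assumes "finite U" "U' \<subseteq> U"
  shows "future_visits U' w \<le> future_visits U w"
  unfolding future_visits_def using assms
  by (intro mult_left_mono sum_mono divide_right_mono harm_mono card_mono) auto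

text \<open>At the scale of \<open>v\<close> the harmonic number loses its last term, which will pay
  for the visits caused by a random insertion at this scale; other scales do not change.\<close>

lemma future_visits_remove:
  assumes "finite U" "v \<in> U" "scale w \<le> scale v" "v \<in> V"
  shows "future_visits U w = future_visits (U - {v}) w +
    2 * card (S w) / (2 ^ scale v * card {x \<in> U. scale x = scale v})"
proof -
  define h where "h = (\<lambda>U k. harm (card {x \<in> U. scale x = k}) / (2 :: real) ^ k)"
  let ?I = "{scale w..top_scale}"
  let ?k = "scale v"
  have mem: "?k \<in> ?I" using assms scale_le_top by auto
  have "{x \<in> U. scale x = ?k} = insert v {x \<in> U - {v}. scale x = ?k}"
    using assms by auto
  then have "card {x \<in> U. scale x = ?k} = Suc (card {x \<in> U - {v}. scale x = ?k})"
    using assms by simp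
  then have "h U ?k = h (U - {v}) ?k + 1 / (2 ^ ?k * card {x \<in> U. scale x = ?k})"
    unfolding h_def
    by (simp only: harm_Suc add_divide_distrib) (simp add: inverse_eq_divide distrib_left mult.commute)
  moreover have "(\<Sum>k\<in>?I - {?k}. h U k) = (\<Sum>k\<in>?I - {?k}. h (U - {v}) k)"
  proof (intro sum.cong refl)
    fix k assume "k \<in> ?I - {?k}"
    then have "{x \<in> U. scale x = k} = {x \<in> U - {v}. scale x = k}" by auto
    then show "h U k = h (U - {v}) k" by (simp only: h_def)
  qed
  ultimately have "(\<Sum>k\<in>?I. h U k) =
      (\<Sum>k\<in>?I. h (U - {v}) k) + 1 / (2 ^ ?k * card {x \<in> U. scale x = ?k})"
    using sum.remove[OF finite_atLeastAtMost mem, of "h U"]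
      sum.remove[OF finite_atLeastAtMost mem, of "h (U - {v})"] by linarith
  then show ?thesis
    unfolding future_visits_def h_def by (simp add: algebra_simps)
qed

text \<open>The geometric series is at most \<open>2 / 2 ^ scale w\<close>, and
  \<open>card (S w) < 2 * 2 ^ scale w\<close>; with the leading 2 this gives 8.\<close>

lemma future_visits_le:
  assumes "finite U" "card U \<le> n"
  shows "future_visits U w \<le> 8 * harm n"
proof -
  have "(\<Sum>k\<in>{scale w..top_scale}. harm (card {v \<in> U. scale v = k}) / 2 ^ k) \<le>
      (\<Sum>k\<in>{scale w..top_scale}. harm n / (2 :: real) ^ k)"
  proof (intro sum_mono divide_right_mono harm_mono)
    fix k
    have "card {v \<in> U. scale v = k} \<le> card U"
      using assms(1) by (intro card_mono) auto
    with assms(2) show "card {v \<in> U. scale v = k} \<le> n" by simp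
  qed auto
  also have "\<dots> = harm n * (\<Sum>k\<in>{scale w..top_scale}. (1 / 2) ^ k)"
    by (simp add: sum_distrib_left power_one_over field_simps)
  also have "(\<Sum>k\<in>{scale w..top_scale}. (1 / 2) ^ k) \<le> 2 * (1 / 2 :: real) ^ scale w"
    unfolding sum_gp by simp
  finally have *: "(\<Sum>k\<in>{scale w..top_scale}. harm (card {v \<in> U. scale v = k}) / 2 ^ k)
      \<le> harm n * (2 / (2 :: real) ^ scale w)"
    by (simp add: harm_nonneg mult_left_mono power_one_over)
  have "future_visits U w \<le> 2 * card (S w) * (harm n * (2 / 2 ^ scale w))"
    unfolding future_visits_def by (intro mult_left_mono *) auto
  also have "\<dots> = (card (S w) / 2 ^ scale w) * (4 * harm n)" by simp
  also have "card (S w) / 2 ^ scale w \<le> (2 :: real)"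
  proof -
    have "real (card (S w)) \<le> real (2 * 2 ^ scale w)"
      using scale_gt[of w] by (intro of_nat_mono) simp
    then show ?thesis by (simp add: field_simps)
  qed
  finally show ?thesis by (simp add: harm_nonneg mult_right_mono)
qed

text \<open>After \<open>green_insert_le\<close> and an exchange of sums, each \<open>x\<close> in
  \<open>A\<close> is counted for at most \<open>card (N x - A)\<close> candidates, so mass
  conservation applies.\<close>

lemma sum_green_insert_le:
  assumes "A \<subseteq> V" "w \<in> A" "C \<subseteq> V - A" "\<And>v. v \<in> C \<Longrightarrow> scale v = K"
  shows "(\<Sum>v\<in>C. green (insert v A) w v) \<le> 2 * card (S w) / 2 ^ K"
proof -
  have fin: "finite A" "finite C"
    using assms finite_V by (auto intro: finite_subset)
  have "(\<Sum>v\<in>C. green (insert v A) w v) \<le> (\<Sum>v\<in>C. 2 / 2 ^ K * (\<Sum>x\<in>N v \<inter> A. green A w x))"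
  proof (rule sum_mono)
    fix v assume v: "v \<in> C"
    have "green (insert v A) w v \<le> 2 / card (S v) * (\<Sum>x\<in>N v \<inter> A. green A w x)"
      using assms v fin by (intro green_insert_le) auto
    also have "2 / real (card (S v)) \<le> 2 / 2 ^ K"
    proof -
      have "real (2 ^ K) \<le> real (card (S v))"
        using scale_le[of v] assms(4)[OF v] by (intro of_nat_mono) simp
      then show ?thesis using s_pos[of v] by (simp add: frac_le)
    qed
    finally show "green (insert v A) w v \<le> 2 / 2 ^ K * (\<Sum>x\<in>N v \<inter> A. green A w x)"
      by (simp add: mult_right_mono sum_nonneg green_nonneg)
  qed
  also have "\<dots> = 2 / 2 ^ K * (\<Sum>v\<in>C. \<Sum>x | x \<in> A \<and> x \<in> N v. green A w x)"
    by (simp add: sum_distrib_left Int_def conj_commute)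
  also have "(\<Sum>v\<in>C. \<Sum>x | x \<in> A \<and> x \<in> N v. green A w x) =
      (\<Sum>x\<in>A. \<Sum>v | v \<in> C \<and> x \<in> N v. green A w x)"
    by (rule sum.swap_restrict[OF fin(2,1)])
  also have "\<dots> \<le> (\<Sum>x\<in>A. card (N x - A) * green A w x)"
  proof (rule sum_mono)
    fix x
    have "{v. v \<in> C \<and> x \<in> N v} \<subseteq> N x - A"
      using assms(3) N_sym by auto
    from card_mono[OF _ this] show "(\<Sum>v | v \<in> C \<and> x \<in> N v. green A w x) \<le> card (N x - A) * green A w x"
      using finite_N[of x] by (simp add: mult_right_mono green_nonneg)
  qed
  also have "\<dots> \<le> card (S w)"
    by (rule sum_boundary_green_le[OF fin(1)])
  finally show ?thesis by (simp add: mult_left_mono divide_right_mono)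
qed

text \<open>For \<open>w\<close> in \<open>A\<close>, the mean factor \<open>1 + y / r\<close> is at
  most \<open>exp (y / r)\<close>, and \<open>future_visits\<close> drops by exactly
  \<open>y / r\<close>. For other \<open>w\<close> the Green function vanishes unless
  \<open>w\<close> is the inserted vertex, which spends its reserve 3.\<close>

lemma insertion_average:
  fixes K :: nat and A :: "'v set"
  assumes "A \<subseteq> V" "\<And>a v. a \<in> A \<Longrightarrow> v \<in> V - A \<Longrightarrow> scale a \<le> scale v"
    and K: "v\<^sub>0 \<in> V - A" "scale v\<^sub>0 = K" and w: "w \<in> V"
  defines "C \<equiv> {v \<in> V - A. scale v = K}"
  shows "(\<Sum>v\<in>C. (1 + green (insert v A) w v) * future_factor (V - insert v A) w)
    \<le> card C * future_factor (V - A) w"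
proof (cases "w \<in> A")
  case True
  define r where "r = real (card C)"
  define y where "y = 2 * card (S w) / (2 ^ K)"
  have "finite C" "C \<noteq> {}" using finite_V K by (auto simp: C_def)
  then have r: "r > 0" by (simp add: r_def card_gt_0_iff)
  \<comment> \<open>Insertion by increasing scale places \<open>K\<close> among the scales that
    \<open>future_visits\<close> counts for \<open>w\<close>.\<close>
  have "scale w \<le> K" using assms True by auto
  define \<rho> where "\<rho> = exp (future_visits (V - A) w - y / r)"
  have "future_factor (V - insert v A) w = \<rho>" if "v \<in> C" for v
  proof -
    have eq: "V - insert v A = V - A - {v}" by auto
    show ?thesis
      using future_visits_remove[of "V - A" v w] that finite_V \<open>scale w \<le> K\<close> True
      by (simp add: eq future_factor_def \<rho>_def y_def r_def C_def field_simps)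
  qed
  then have "(\<Sum>v\<in>C. (1 + green (insert v A) w v) * future_factor (V - insert v A) w) =
      (r + (\<Sum>v\<in>C. green (insert v A) w v)) * \<rho>"
    by (simp add: sum_distrib_right[symmetric] sum.distrib r_def)
  also have "\<dots> \<le> (r + y) * \<rho>"
  proof (intro mult_right_mono add_left_mono)
    show "(\<Sum>v\<in>C. green (insert v A) w v) \<le> y"
      unfolding y_def by (rule sum_green_insert_le[OF assms(1) True]) (auto simp: C_def)
  qed (simp add: \<rho>_def)
  also have "\<dots> = r * (1 + y / r) * \<rho>" using r by (simp add: field_simps)
  also have "\<dots> \<le> r * exp (y / r) * \<rho>"
    using r exp_ge_add_one_self[of "y / r"]
    by (intro mult_right_mono mult_left_mono) (auto simp: \<rho>_def)
  also have "\<dots> = r * future_factor (V - A) w"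
    using True by (simp add: \<rho>_def future_factor_def mult.assoc flip: exp_add)
  finally show ?thesis by (simp add: r_def)
next
  case False
  have "(1 + green (insert v A) w v) * future_factor (V - insert v A) w \<le> future_factor (V - A) w"
    if v: "v \<in> C" for v
  proof -
    have mono: "exp (future_visits (V - insert v A) w) \<le> exp (future_visits (V - A) w)"
      using finite_V by (simp, intro future_visits_mono) auto
    show ?thesis
    proof (cases "w = v")
      case True
      have "(1 + green (insert v A) w v) * exp (future_visits (V - insert v A) w) \<le>
          3 * exp (future_visits (V - A) w)"
        using green_le[of "insert v A" w v] green_nonneg[of "insert v A" w v] True mono
        by (intro mult_mono) auto
      then show ?thesis using True False w by (simp add: future_factor_def)
    next
      case False
      with \<open>w \<notin> A\<close> have "green (insert v A) w v = 0"
        by (intro green_zero) auto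
      with False mono \<open>w \<notin> A\<close> w show ?thesis by (simp add: future_factor_def)
    qed
  qed
  then show ?thesis
    using sum_mono[of C "\<lambda>v. (1 + green (insert v A) w v) * future_factor (V - insert v A) w"
        "\<lambda>_. future_factor (V - A) w"] by simp
qed

text \<open>The left side does not depend on the vertex inserted next, so the bounds for all
  candidates may be averaged; no good candidate has to be exhibited.\<close>

lemma idle_bound:
  assumes "A \<subseteq> V" "\<And>a v. a \<in> A \<Longrightarrow> v \<in> V - A \<Longrightarrow> scale a \<le> scale v"
    and "valid_state A f L vis"
  shows "(6 / 5) ^ l * F L \<le> idle_potential vis (future_factor (V - A))"
  using assms
proof (induction "card (V - A)" arbitrary: A f L vis rule: less_induct)
  case less
  show ?case
  proof (cases "V - A = {}")
    case True
    with less.prems have [simp]: "A = V" by auto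
    have "F L = 0"
    proof (rule F_colorable)
      show "L u \<subseteq> S u \<and> card (L u) \<le> l" if "u \<in> V" for u
        using less.prems(3) that by (auto simp: valid_state_def)
      show "f u \<in> L u" if "u \<in> V" for u
        using less.prems(3) that by (auto simp: valid_state_def)
      show "f u \<noteq> f x" if "u \<in> V" "x \<in> N u" for u x
        using less.prems(3) that N_subset[of u] unfolding valid_state_def \<open>A = V\<close> by blast
    qed
    then show ?thesis
      unfolding idle_potential_def using order_trans[OF zero_le_one future_factor_ge_1]
      by (auto intro!: sum_nonneg)
  next
    case False
    \<comment> \<open>Taking the lowest remaining scale preserves the order hypothesis for
      \<open>insert v A\<close>.\<close>
    define K where "K = Min (scale ` (V - A))"
    have fin: "finite (scale ` (V - A))" using finite_V by simp
    have "K \<in> scale ` (V - A)"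
      unfolding K_def using False fin by (intro Min_in) auto
    then obtain v\<^sub>0 where v\<^sub>0: "v\<^sub>0 \<in> V - A" "scale v\<^sub>0 = K" by auto
    have K_le: "K \<le> scale v" if "v \<in> V - A" for v
      unfolding K_def using fin that by auto
    define C where "C = {v \<in> V - A. scale v = K}"
    have C: "finite C" "C \<noteq> {}" using finite_V v\<^sub>0 by (auto simp: C_def)
    let ?X = "(6 / 5) ^ l * F L"
    have bound: "?X \<le> token_potential (insert v A) v vis (future_factor (V - insert v A))"
      if v: "v \<in> C" for v
    proof (rule token_bound)
      show "insert v A \<subseteq> V" "v \<in> insert v A"
        using v less.prems(1) by (auto simp: C_def)
      show "future_factor (V - insert v A) w \<ge> 1" for w
        by (rule future_factor_ge_1)
      show "valid_state (insert v A - {v}) f L vis"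
        using v less.prems(3) by (auto simp: C_def)
      show "(6 / 5) ^ l * F L' \<le> idle_potential vis' (future_factor (V - insert v A))"
        if "valid_state (insert v A) f' L' vis'" for f' L' vis'
      proof (rule less.hyps)
        show "card (V - insert v A) < card (V - A)"
          using v finite_V by (intro psubset_card_mono) (auto simp: C_def)
        show "insert v A \<subseteq> V"
          using v less.prems(1) by (auto simp: C_def)
        show "scale a \<le> scale x" if "a \<in> insert v A" "x \<in> V - insert v A" for a x
          using that v less.prems(2)[of a x] K_le[of x] by (auto simp: C_def)
      qed (rule that)
    qed
    have "card C * ?X = (\<Sum>v\<in>C. ?X)" by simp
    also have "\<dots> \<le> (\<Sum>v\<in>C. token_potential (insert v A) v vis (future_factor (V - insert v A)))"
      by (intro sum_mono bound)
    also have "\<dots> = (\<Sum>w\<in>V. (6 / 5) ^ vis w *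
        (\<Sum>v\<in>C. (1 + green (insert v A) w v) * future_factor (V - insert v A) w))"
      unfolding token_potential_def by (subst sum.swap) (simp add: sum_distrib_left mult.assoc)
    also have "\<dots> \<le> (\<Sum>w\<in>V. (6 / 5) ^ vis w * (card C * future_factor (V - A) w))"
      unfolding C_def using less.prems(1,2) v\<^sub>0
      by (intro sum_mono mult_left_mono insertion_average) auto
    also have "\<dots> = card C * idle_potential vis (future_factor (V - A))"
      by (simp add: idle_potential_def sum_distrib_left mult_ac)
    finally show ?thesis
      using C by (simp add: card_gt_0_iff)
  qed
qed

theorem failure_le: "F (\<lambda>_. {}) \<le> 3 * real (card V) * exp (8 * harm (card V)) * (5 / 6) ^ l"
proof -
  have "(6 / 5) ^ l * F (\<lambda>_. {}) \<le> idle_potential (\<lambda>_. 0) (future_factor (V - {}))"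
    by (rule idle_bound[of _ undefined]) (auto simp: valid_state_def)
  also have "\<dots> \<le> (\<Sum>w\<in>V. 3 * exp (8 * harm (card V)))"
    unfolding idle_potential_def
    using future_visits_le[OF finite_V order_refl] by (intro sum_mono) (simp add: future_factor_def)
  finally have "(6 / 5) ^ l * F (\<lambda>_. {}) \<le> 3 * real (card V) * exp (8 * harm (card V))"
    by (simp add: mult_ac)
  then have "(5 / 6) ^ l * ((6 / 5) ^ l * F (\<lambda>_. {})) \<le>
      (5 / 6) ^ l * (3 * real (card V) * exp (8 * harm (card V)))"
    by (intro mult_left_mono) auto
  also have "(5 / 6) ^ l * ((6 / 5) ^ l * F (\<lambda>_. {})) = F (\<lambda>_. {})"
    by (simp flip: mult.assoc power_mult_distrib)
  finally show ?thesis by (simp add: mult_ac)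
qed

end

section \<open>Revealing random lists\<close>

lemma card_supersets:
  assumes "finite S" "L \<subseteq> S" "card L \<le> k"
  shows "card {A. L \<subseteq> A \<and> A \<subseteq> S \<and> card A = k} = (card S - card L) choose (k - card L)"
proof -
  have fin: "finite L" using assms finite_subset by blast
  have "bij_betw (\<lambda>B. L \<union> B) {B. B \<subseteq> S - L \<and> card B = k - card L}
      {A. L \<subseteq> A \<and> A \<subseteq> S \<and> card A = k}"
  proof (rule bij_betwI[where g = "\<lambda>A. A - L"])
    show "(\<lambda>B. L \<union> B) \<in> {B. B \<subseteq> S - L \<and> card B = k - card L} \<rightarrow>
        {A. L \<subseteq> A \<and> A \<subseteq> S \<and> card A = k}"
    proof (rule Pi_I)
      fix B assume "B \<in> {B. B \<subseteq> S - L \<and> card B = k - card L}"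
      then have B: "B \<subseteq> S - L" "card B = k - card L" by auto
      have "card (L \<union> B) = card L + card B"
        using B fin assms(1) by (intro card_Un_disjoint) (auto intro: finite_subset)
      with B assms show "L \<union> B \<in> {A. L \<subseteq> A \<and> A \<subseteq> S \<and> card A = k}" by auto
    qed
    show "(\<lambda>A. A - L) \<in> {A. L \<subseteq> A \<and> A \<subseteq> S \<and> card A = k} \<rightarrow>
        {B. B \<subseteq> S - L \<and> card B = k - card L}"
      using fin by (auto simp: card_Diff_subset)
  qed auto
  from bij_betw_same_card[OF this]
  have "card {A. L \<subseteq> A \<and> A \<subseteq> S \<and> card A = k} = card {B. B \<subseteq> S - L \<and> card B = k - card L}"
    by simp
  also have "\<dots> = (card S - card L) choose (k - card L)"
    using assms fin by (simp add: n_subsets card_Diff_subset)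
  finally show ?thesis .
qed

text \<open>
  Drawing \<open>c\<close> from all of \<open>S\<close> rather than from \<open>S - L\<close> costs nothing: a repeated color leaves the
  distribution as it is.
\<close>
lemma pmf_of_set_supersets:
  fixes S L :: "'c set"
  assumes "finite S" "L \<subseteq> S" "card L < k" "k \<le> card S"
  defines "X \<equiv> \<lambda>L. {A. L \<subseteq> A \<and> A \<subseteq> S \<and> card A = k}"
  shows "pmf_of_set (X L) = bind_pmf (pmf_of_set S) (\<lambda>c. pmf_of_set (X (insert c L)))"
proof (rule pmf_eqI)
  fix A
  define r where "r = card L"
  have fin: "finite L" using assms finite_subset by blast
  have S: "S \<noteq> {}" using assms by auto
  have fin_X: "finite (X M)" for M
    by (rule finite_subset[of _ "Pow S"]) (auto simp: X_def assms(1))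
  have card_X: "card (X L) = (card S - r) choose (k - r)"
    unfolding X_def r_def using assms by (intro card_supersets) auto
  have "card (X L) > 0"
    unfolding card_X using assms(3,4) by (simp add: r_def)
  then have X_ne: "X L \<noteq> {}" by auto
  have in_L: "X (insert c L) = X L" if "c \<in> L" for c
    by (simp only: insert_absorb[OF that])
  have card_X': "card (X (insert c L)) = (card S - Suc r) choose (k - Suc r)"
    if "c \<in> S - L" for c
    using that card_supersets[of S "insert c L" k] assms(1-4) fin by (simp add: X_def r_def)
  have X_ne': "X (insert c L) \<noteq> {}" if "c \<in> S - L" for c
  proof -
    have "card (X (insert c L)) > 0"
      unfolding card_X'[OF that] using assms(3,4) by (simp add: r_def)
    then show ?thesis by auto
  qed
  define p where "p = 1 / real (card (X L))"
  define q where "q = 1 / real ((card S - Suc r) choose (k - Suc r))"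
  \<comment> \<open>Binomial absorption. A set \<open>A\<close> in \<open>X L\<close> arises from
    \<open>k - r\<close> fresh colors with weight \<open>q\<close> each; they weigh as much as
    \<open>card S - r\<close> copies of \<open>p\<close>, complementing the \<open>r\<close>
    repeated colors.\<close>
  have absorb: "real (k - r) * q = real (card S - r) * p"
  proof -
    have "(k - r) * ((card S - r) choose (k - r)) =
        (card S - r) * ((card S - Suc r) choose (k - Suc r))"
      using assms times_binomial_minus1_eq[of "k - r" "card S - r"] by (simp add: r_def)
    then have "real (k - r) * real ((card S - r) choose (k - r)) =
        real (card S - r) * real ((card S - Suc r) choose (k - Suc r))"
      by (simp flip: of_nat_mult)
    moreover have "((card S - r) choose (k - r)) > 0" "((card S - Suc r) choose (k - Suc r)) > 0"
      using assms by (auto simp: r_def)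
    ultimately show ?thesis
      unfolding p_def q_def card_X by (simp add: field_simps)
  qed
  have "pmf (bind_pmf (pmf_of_set S) (\<lambda>c. pmf_of_set (X (insert c L)))) A =
      (\<Sum>c\<in>S. pmf (pmf_of_set (X (insert c L))) A) / card S"
    using S assms by (simp add: pmf_bind_pmf_of_set)
  also have "(\<Sum>c\<in>S. pmf (pmf_of_set (X (insert c L))) A) =
      (\<Sum>c\<in>L. pmf (pmf_of_set (X (insert c L))) A) +
      (\<Sum>c\<in>S - L. pmf (pmf_of_set (X (insert c L))) A)"
    using assms by (simp add: sum.subset_diff add.commute)
  also have "(\<Sum>c\<in>L. pmf (pmf_of_set (X (insert c L))) A) = r * pmf (pmf_of_set (X L)) A"
    by (simp add: in_L r_def)
  also have "(\<Sum>c\<in>S - L. pmf (pmf_of_set (X (insert c L))) A) =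
      (\<Sum>c\<in>S - L. of_bool (A \<in> X (insert c L)) * q)"
    using fin_X X_ne' card_X' by (intro sum.cong refl) (simp add: q_def)
  also have "\<dots> = real (card S - r) * pmf (pmf_of_set (X L)) A"
  proof (cases "A \<in> X L")
    case True
    then have A: "L \<subseteq> A" "A \<subseteq> S" "card A = k" by (auto simp: X_def)
    have "(\<Sum>c\<in>S - L. of_bool (A \<in> X (insert c L)) * q) = (\<Sum>c\<in>S - L. if c \<in> A - L then q else 0)"
      using A by (intro sum.cong refl) (auto simp: X_def)
    also have "\<dots> = (\<Sum>c\<in>A - L. q)"
    proof -
      have "(S - L) \<inter> (A - L) = A - L" using A by auto
      with sum.inter_restrict[of "S - L" "\<lambda>_. q" "A - L"] assms(1) show ?thesis by simp
    qed
    also have "\<dots> = real (k - r) * q"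
      using A fin by (simp add: card_Diff_subset r_def)
    finally show ?thesis
      using True fin_X X_ne absorb by (simp add: p_def)
  next
    case False
    then have "A \<notin> X (insert c L)" for c by (auto simp: X_def)
    with False fin_X X_ne show ?thesis by simp
  qed
  finally have "pmf (bind_pmf (pmf_of_set S) (\<lambda>c. pmf_of_set (X (insert c L)))) A =
      (real r + real (card S - r)) * pmf (pmf_of_set (X L)) A / card S"
    by (simp add: distrib_right)
  moreover have "real r + real (card S - r) = card S" "card S > 0"
    using assms S by (auto simp: r_def card_gt_0_iff)
  ultimately show "pmf (pmf_of_set (X L)) A =
      pmf (bind_pmf (pmf_of_set S) (\<lambda>c. pmf_of_set (X (insert c L)))) A"
    by simp
qed

lemma Pi_pmf_bind_component:
  assumes "finite V" "u \<in> V" "p u = bind_pmf q h"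
  shows "Pi_pmf V d p = bind_pmf q (\<lambda>c. Pi_pmf V d (p(u := h c)))"
proof -
  define W where "W = V - {u}"
  have V: "V = insert u W" "u \<notin> W" "finite W" using assms by (auto simp: W_def)
  have W: "Pi_pmf W d (p(u := x)) = Pi_pmf W d p" for x
    using V by (intro Pi_pmf_cong) auto
  show ?thesis
    unfolding V(1) Pi_pmf_insert'[OF V(3,2)] assms(3)
    by (simp add: bind_assoc_pmf W)
qed

lemma prob_bind_pmf_of_set:
  assumes "finite S" "S \<noteq> {}"
  shows "measure_pmf.prob (bind_pmf (pmf_of_set S) f) X = (\<Sum>c\<in>S. measure_pmf.prob (f c) X) / card S"
proof -
  have "ennreal (measure_pmf.prob (bind_pmf (pmf_of_set S) f) X) =
      (\<integral>\<^sup>+ c. ennreal (measure_pmf.prob (f c) X) \<partial>pmf_of_set S)"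
    by (simp flip: measure_pmf.emeasure_eq_measure)
  also have "\<dots> = ennreal ((\<Sum>c\<in>S. measure_pmf.prob (f c) X) / card S)"
    using assms by (subst nn_integral_pmf_of_set)
      (auto simp: sum_ennreal divide_ennreal sum_nonneg card_gt_0_iff ennreal_of_nat_eq_real_of_nat)
  finally show ?thesis
    by (simp add: sum_nonneg)
qed

text \<open>The law of \<open>sample_lists\<close> conditioned on containing the parts
  \<open>L\<close>, provided these lie in \<open>S\<close> and fit into the sampled sizes.\<close>

definition revealed_lists ::
    "'v set \<Rightarrow> ('v \<Rightarrow> 'c set) \<Rightarrow> nat \<Rightarrow> ('v \<Rightarrow> 'c set) \<Rightarrow> ('v \<Rightarrow> 'c set) pmf" where
  "revealed_lists V S l L =
     Pi_pmf V {} (\<lambda>v. pmf_of_set {A. L v \<subseteq> A \<and> A \<subseteq> S v \<and> card A = min l (card (S v))})"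

text \<open>Makes success final: a coloring from the revealed parts remains one from the completed
  lists.\<close>

lemma revealed_lists_superset:
  assumes "finite V" "u \<in> V" "finite (S u)" "L u \<subseteq> S u" "card (L u) \<le> l"
    and "L' \<in> set_pmf (revealed_lists V S l L)"
  shows "L u \<subseteq> L' u"
proof -
  let ?X = "{A. L u \<subseteq> A \<and> A \<subseteq> S u \<and> card A = min l (card (S u))}"
  have "card (L u) \<le> card (S u)" using assms by (intro card_mono)
  then have "card ?X > 0"
    using card_supersets[of "S u" "L u" "min l (card (S u))"] assms(3-5) by simp
  then have "?X \<noteq> {}" by (metis card.empty less_irrefl)
  moreover have "finite ?X"
    by (rule finite_subset[of _ "Pow (S u)"]) (use assms in auto)
  moreover have "L' u \<in> set_pmf (pmf_of_set ?X)"
    using assms(6) unfolding revealed_lists_def set_Pi_pmf[OF assms(1)]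
    using assms(2) by (auto simp: PiE_dflt_def)
  ultimately show ?thesis by (simp add: set_pmf_of_set)
qed

lemma revealed_lists_average:
  assumes "finite V" "u \<in> V" "finite (S u)" "S u \<noteq> {}" "L u \<subseteq> S u" "card (L u) < l"
  shows "measure_pmf.prob (revealed_lists V S l L) X =
    (\<Sum>c\<in>S u. measure_pmf.prob (revealed_lists V S l (L(u := insert c (L u)))) X) / card (S u)"
proof (cases "L u = S u")
  \<comment> \<open>If the cap is \<open>card (S u) < l\<close>, all colors can be revealed before
    \<open>l\<close> is reached; every further draw is then a repetition.\<close>
  case True
  then have "L(u := insert c (L u)) = L" if "c \<in> S u" for c
    using that by (intro fun_upd_idem) (simp add: insert_absorb)
  then show ?thesis using assms by simp
next
  case False
  let ?k = "min l (card (S u))"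
  let ?p = "\<lambda>L v. pmf_of_set {A. L v \<subseteq> A \<and> A \<subseteq> S v \<and> card A = min l (card (S v))}"
  have "card (L u) < card (S u)"
    using False assms by (intro psubset_card_mono) auto
  then have "?p L u = bind_pmf (pmf_of_set (S u))
      (\<lambda>c. pmf_of_set {A. insert c (L u) \<subseteq> A \<and> A \<subseteq> S u \<and> card A = ?k})"
    using assms by (intro pmf_of_set_supersets) auto
  from Pi_pmf_bind_component[where p = "?p L", OF assms(1,2) this, of "{}"]
  have "revealed_lists V S l L = bind_pmf (pmf_of_set (S u)) (\<lambda>c. Pi_pmf V {} ((?p L)
      (u := pmf_of_set {A. insert c (L u) \<subseteq> A \<and> A \<subseteq> S u \<and> card A = ?k})))"
    by (simp add: revealed_lists_def)
  also have "\<dots> = bind_pmf (pmf_of_set (S u)) (\<lambda>c. revealed_lists V S l (L(u := insert c (L u))))"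
    unfolding revealed_lists_def by (intro bind_pmf_cong refl Pi_pmf_cong) auto
  finally show ?thesis
    using assms by (simp add: prob_bind_pmf_of_set)
qed

section \<open>Failure probability for simple graphs\<close>

lemma card_neighbours:
  assumes "simple_graph V E"
  shows "card {x. {u, x} \<in> E} = vertex_degree E u"
proof -
  have "bij_betw (\<lambda>x. {u, x}) {x. {u, x} \<in> E} {e \<in> E. u \<in> e}"
  proof (rule bij_betw_imageI)
    show "inj_on (\<lambda>x. {u, x}) {x. {u, x} \<in> E}"
      by (auto simp: inj_on_def doubleton_eq_iff)
    have "\<exists>x. e = {u, x}" if "e \<in> E" "u \<in> e" for e
    proof -
      have "card e = 2" using assms that by (auto simp: simple_graph_def)
      then show ?thesis using that by (auto simp: card_2_iff)
    qed
    then show "(\<lambda>x. {u, x}) ` {x. {u, x} \<in> E} = {e \<in> E. u \<in> e}" by blast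
  qed
  then show ?thesis
    unfolding vertex_degree_def by (rule bij_betw_same_card)
qed

theorem prob_not_list_colorable_le:
  fixes V :: "'v set" and E :: "'v set set" and S :: "'v \<Rightarrow> 'c set"
  assumes G: "simple_graph V E" and S: "\<And>v. v \<in> V \<Longrightarrow> vertex_degree E v < card (S v)"
  shows "1 - prob_list_colorable V E S l \<le>
    3 * real (card V) * exp (8 * harm (card V)) * (5 / 6) ^ l"
proof -
  \<comment> \<open>The locale constrains every element of the type; outside \<open>V\<close> a
    dummy list of one color exceeds the degree 0.\<close>
  define S' where "S' v = (if v \<in> V then S v else {undefined})" for v
  define N where "N u = {x. {u, x} \<in> E}" for u
  define bad where "bad = {L :: 'v \<Rightarrow> 'c set. \<not> list_colorable V E L}"
  define F where "F L = measure_pmf.prob (revealed_lists V S' l L) bad" for L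
  have fin: "finite V" using G by (simp add: simple_graph_def)
  have edge: "e \<subseteq> V \<and> card e = 2" if "e \<in> E" for e
    using G that by (simp add: simple_graph_def)
  have N_V: "N u \<subseteq> V" "N u \<noteq> {} \<Longrightarrow> u \<in> V" for u
    using edge by (auto simp: N_def)
  have fin_N: "finite (N u)" for u
    using N_V fin finite_subset by blast
  interpret sampled_graph V N "\<lambda>v. card (S' v)"
  proof
    show "u \<notin> N u" for u using edge[of "{u}"] by (auto simp: N_def)
    show "card (N u) < card (S' u)" for u
    proof (cases "u \<in> V")
      case True
      then show ?thesis
        using S card_neighbours[OF G, of u] by (simp add: S'_def N_def)
    next
      case False
      with N_V(2)[of u] have "N u = {}" by auto
      then show ?thesis using False by (simp add: S'_def)
    qed
    show "x \<in> N u \<longleftrightarrow> u \<in> N x" for x u by (simp add: N_def insert_commute)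
  qed (fact fin fin_N)+
  have fin_S: "finite (S' v)" "S' v \<noteq> {}" for v
    using s_pos[of v] card_ge_0_finite by auto
  interpret list_revealing V N S' l F
  proof
    show "F L \<le> 1" for L unfolding F_def by simp
    show "F L = (\<Sum>c\<in>S' u. F (L(u := insert c (L u)))) / card (S' u)"
      if "u \<in> V" "L u \<subseteq> S' u" "card (L u) < l" for L u
      unfolding F_def using that fin fin_S by (intro revealed_lists_average)
    show "F L = 0"
      if L: "\<And>u. u \<in> V \<Longrightarrow> L u \<subseteq> S' u \<and> card (L u) \<le> l"
        and f: "\<And>u. u \<in> V \<Longrightarrow> f u \<in> L u" "\<And>u x. u \<in> V \<Longrightarrow> x \<in> N u \<Longrightarrow> f u \<noteq> f x" for L f
    proof -
      have "proper_coloring E f"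
        unfolding proper_coloring_def using f(2) edge by (auto simp: N_def)
      then have "list_colorable V E L'" if "L' \<in> set_pmf (revealed_lists V S' l L)" for L'
        unfolding list_colorable_def
        using revealed_lists_superset[OF fin _ fin_S(1) _ _ that] L f(1) by blast
      then have "set_pmf (revealed_lists V S' l L) \<inter> bad = {}"
        by (auto simp: bad_def)
      then show ?thesis
        unfolding F_def by (simp add: measure_pmf_zero_iff)
    qed
  qed (use N_V in auto)
  have "revealed_lists V S' l (\<lambda>_. {}) = sample_lists V S l"
    unfolding revealed_lists_def sample_lists_def S'_def by (intro Pi_pmf_cong) auto
  moreover have "bad = - {L. list_colorable V E L}" by (auto simp: bad_def)
  ultimately have "F (\<lambda>_. {}) = 1 - prob_list_colorable V E S l"
    unfolding F_def prob_list_colorable_def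
    using measure_pmf.prob_compl[of "{L. list_colorable V E L}" "sample_lists V S l"]
    by (simp add: Compl_eq_Diff_UNIV)
  with failure_le show ?thesis by simp
qed

section \<open>High probability and the choice of constants\<close>

lemma harm_le_1_plus_ln:
  assumes "n \<ge> 1"
  shows "harm n \<le> 1 + ln (real n)"
proof -
  obtain m where n: "n = Suc m" using assms by (cases n) auto
  have "harm (Suc m) - ln (real (Suc m)) \<le> harm (Suc 0) - ln (real (Suc 0))"
    using decseqD[OF decseq_harm_diff_ln, of 0 m] by simp
  then show ?thesis by (simp add: n harm_Suc harm_def)
qed

text \<open>With \<open>x = ln n\<close>, the factors before \<open>(5 / 6) ^ l\<close> are at most
  \<open>exp (10 + 9 * x)\<close>. Of the 24, 9 cancel the powers of \<open>n\<close> and 15 absorb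
  the 10, as \<open>x\<close> is at least 2/3 for \<open>n\<close> at least 2.\<close>

lemma prob_list_colorable_ge:
  fixes c C :: real
  assumes "simple_graph V E" "\<And>v. v \<in> V \<Longrightarrow> vertex_degree E v < card (S v)"
    and c: "c > 0" and C: "C * ln (6 / 5) \<ge> c + 24" and l: "real l \<ge> C * ln (card V)"
  shows "prob_list_colorable V E S l \<ge> 1 - 1 / card V powr c"
proof -
  let ?n = "real (card V)"
  \<comment> \<open>For the empty graph \<open>1 / 0 powr c\<close> is 0, so probability 1 is
    claimed; the factor \<open>card V\<close> in the failure bound gives it. For one vertex the
    claimed bound is 0.\<close>
  consider "card V = 0" | "card V = 1" | "card V \<ge> 2" by linarith
  then show ?thesis
  proof cases
    case 1
    then show ?thesis
      using prob_not_list_colorable_le[OF assms(1,2), where l = l] by simp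
  next
    case 2
    then show ?thesis by (simp add: prob_list_colorable_def)
  next
    case 3
    define x where "x = ln ?n"
    have "ln 2 \<le> x" using 3 by (simp add: x_def)
    with ln2_ge_two_thirds have x: "x \<ge> 2 / 3" by linarith
    have n: "?n = exp x" using 3 by (simp add: x_def)
    have three: "(3 :: real) \<le> exp 2" using exp_ge_add_one_self[of "2 :: real"] by simp
    have pow: "(5 / 6 :: real) ^ l = exp (- (l * ln (6 / 5)))"
      by (simp add: exp_minus exp_of_nat_mult power_divide)
    have "(c + 24) * x \<le> C * ln (6 / 5) * x"
      using C x by (intro mult_right_mono) auto
    also have "\<dots> = (C * x) * ln (6 / 5)" by simp
    also have "\<dots> \<le> l * ln (6 / 5)"
      using l by (intro mult_right_mono) (auto simp: x_def)
    finally have l': "l * ln (6 / 5) \<ge> (c + 24) * x" .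
    have "1 - prob_list_colorable V E S l \<le> 3 * ?n * exp (8 * harm (card V)) * (5 / 6) ^ l"
      by (rule prob_not_list_colorable_le[OF assms(1,2)])
    also have "\<dots> \<le> exp 2 * exp x * exp (8 * (1 + x)) * exp (- ((c + 24) * x))"
      unfolding pow n using three l' harm_le_1_plus_ln[of "card V"] 3
      by (intro mult_mono mult_right_mono) (auto simp: x_def)
    also have "\<dots> = exp (10 - (c + 15) * x)"
      by (simp add: algebra_simps flip: exp_add)
    also have "\<dots> \<le> exp (- c * x)"
      using x by (simp add: algebra_simps)
    also have "\<dots> = 1 / ?n powr c"
      using 3 by (simp add: powr_def x_def exp_minus divide_inverse)
    finally show ?thesis by simp
  qed
qed

lemma num_colors_gt:
  assumes "\<epsilon> > 0"
  shows "d < num_colors \<epsilon> d"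
proof (cases "d = 0")
  case False
  then have "real d < (1 + \<epsilon>) * d" using assms by (simp add: algebra_simps)
  also have "\<dots> \<le> real_of_int \<lceil>(1 + \<epsilon>) * d\<rceil>" by simp
  finally have "int d < \<lceil>(1 + \<epsilon>) * d\<rceil>" by linarith
  then show ?thesis by (simp add: num_colors_def)
qed (simp add: num_colors_def)

theorem theorem4p1:
  fixes c :: real
  assumes "c > 0"
  shows
    "(\<forall>\<epsilon>\<^sub>0 > 0. \<exists>C\<^sub>0 > 0. \<forall>C \<ge> C\<^sub>0. \<forall>\<epsilon>::real. 0 < \<epsilon> \<and> \<epsilon> \<le> \<epsilon>\<^sub>0 \<longrightarrow>
        (\<forall>(V :: 'v set) E (S :: 'v \<Rightarrow> 'c set).
           simple_graph V E \<and> (\<forall>v\<in>V. card (S v) = num_colors \<epsilon> (vertex_degree E v)) \<longrightarrow>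
           prob_list_colorable V E S (nat \<lceil>C * (1 / \<epsilon>) * ln (real (card V))\<rceil>)
             \<ge> 1 - 1 / real (card V) powr c))
     \<and>
     (\<exists>C\<^sub>0 > 0. \<forall>C \<ge> C\<^sub>0.
        (\<forall>(V :: 'v set) E (S :: 'v \<Rightarrow> nat set).
           simple_graph V E \<and> (\<forall>v\<in>V. S v = {1..vertex_degree E v + 1}) \<longrightarrow>
           prob_list_colorable V E S (nat \<lceil>C * ln (real (card V))\<rceil>)
             \<ge> 1 - 1 / real (card V) powr c))"
proof -
  define K where "K = (c + 24) / ln (6 / 5)"
  have K: "K > 0" using assms by (simp add: K_def)
  have K_le: "c + 24 \<le> C * ln (6 / 5)" if "K \<le> C" for C
    using that by (simp add: K_def pos_divide_le_eq)
  have list_size: "real (nat \<lceil>y\<rceil>) \<ge> y" for y :: real by linarith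
  show ?thesis
  proof (intro conjI allI impI)
    fix \<epsilon>\<^sub>0 :: real assume \<epsilon>\<^sub>0: "\<epsilon>\<^sub>0 > 0"
    show "\<exists>C\<^sub>0 > 0. \<forall>C \<ge> C\<^sub>0. \<forall>\<epsilon>::real. 0 < \<epsilon> \<and> \<epsilon> \<le> \<epsilon>\<^sub>0 \<longrightarrow>
        (\<forall>(V :: 'v set) E (S :: 'v \<Rightarrow> 'c set).
           simple_graph V E \<and> (\<forall>v\<in>V. card (S v) = num_colors \<epsilon> (vertex_degree E v)) \<longrightarrow>
           prob_list_colorable V E S (nat \<lceil>C * (1 / \<epsilon>) * ln (real (card V))\<rceil>)
             \<ge> 1 - 1 / real (card V) powr c)"
    \<comment> \<open>As \<epsilon> is at most \<open>\<epsilon>\<^sub>0\<close>, this choice makes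
      \<open>C * (1 / \<epsilon>)\<close> at least \<open>K\<close>, the constant that also serves
      the second part.\<close>
    proof (intro exI[of _ "K * \<epsilon>\<^sub>0"] conjI allI impI)
      show "K * \<epsilon>\<^sub>0 > 0" using K \<epsilon>\<^sub>0 by simp
      fix C \<epsilon> :: real and V :: "'v set" and E and S :: "'v \<Rightarrow> 'c set"
      assume C: "K * \<epsilon>\<^sub>0 \<le> C" and \<epsilon>: "0 < \<epsilon> \<and> \<epsilon> \<le> \<epsilon>\<^sub>0"
        and G: "simple_graph V E \<and> (\<forall>v\<in>V. card (S v) = num_colors \<epsilon> (vertex_degree E v))"
      have "K * \<epsilon> \<le> K * \<epsilon>\<^sub>0" using K \<epsilon> by simp
      with C \<epsilon> have "K \<le> C * (1 / \<epsilon>)" by (simp add: field_simps)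
      then show "prob_list_colorable V E S (nat \<lceil>C * (1 / \<epsilon>) * ln (real (card V))\<rceil>)
          \<ge> 1 - 1 / real (card V) powr c"
        using G \<epsilon> assms by (intro prob_list_colorable_ge[OF _ _ _ K_le list_size])
          (auto simp: num_colors_gt)
    qed
  next
    show "\<exists>C\<^sub>0 > 0. \<forall>C \<ge> C\<^sub>0.
        (\<forall>(V :: 'v set) E (S :: 'v \<Rightarrow> nat set).
           simple_graph V E \<and> (\<forall>v\<in>V. S v = {1..vertex_degree E v + 1}) \<longrightarrow>
           prob_list_colorable V E S (nat \<lceil>C * ln (real (card V))\<rceil>)
             \<ge> 1 - 1 / real (card V) powr c)"
      using K assms by (intro exI[of _ K] conjI allI impI prob_list_colorable_ge[OF _ _ _ K_le list_size])
        auto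
  qed
qed

end
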